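(* Let $\mathsf{C}([0,\omega_1])$ carry the metric uniformity of its sup norm $\|\cdot\|$, and let $$\mathsf{M}:=\{f\in \mathsf{C}([0,\omega_1]) \mid f \text{ is monotone non-increasing},\ f(0)=1 \text{ and } f(\omega_1)=0\}$$ with the subspace metric. Then the uniform spaces $\mathsf{p}_1\mathsf{M}$ and $\mathsf{p}_1\mathsf{C}([0,\omega_1])$ (the separable modifications of $\mathsf{M}$ and of $\mathsf{C}([0,\omega_1])$) are not complete.
   Context: $\mathsf{C}([0,\omega_1])$ is the Banach space of continuous real-valued functions on the compact ordinal space $[0,\omega_1]$ (order topology, $\omega_1$ the first uncountable ordinal), with the sup norm. For a uniform space $X$, the separable modification $\mathsf{p}_1 X$ is the uniform space on the same set of points whose uniformity is projectively generated by all uniformly continuous mappings from $X$ to separable metric spaces, i.e. it is the coarsest uniformity making all these mappings uniformly continuous. A uniform space is complete if every Cauchy filter converges. *)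

theory Defs
  imports "HOL-Analysis.Analysis" "HOL-Library.Countable_Set_Type"
begin

section \<open>The ordinal space $[0,\omega_1]$\<close>

text \<open>The cardinal successor of the well-order of the natural numbers is a well-order of type
  $\omega_1$; its elements are the countable ordinals.\<close>

typedef omega1 = "Field (cardSuc natLeq)"
  morphisms rep_omega1 abs_omega1
  using Field_cardSuc_not_empty[OF natLeq_Card_order] by auto

lemma Well_order_cardSuc_natLeq: "Well_order (cardSuc natLeq)"
  by (rule cardSuc_Well_order[OF natLeq_Card_order])

instantiation omega1 :: linorder
begin

definition less_eq_omega1 :: "omega1 \<Rightarrow> omega1 \<Rightarrow> bool"
  where "less_eq_omega1 x y \<longleftrightarrow> (rep_omega1 x, rep_omega1 y) \<in> cardSuc natLeq"

definition less_omega1 :: "omega1 \<Rightarrow> omega1 \<Rightarrow> bool"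
  where "less_omega1 x y \<longleftrightarrow> x \<le> y \<and> \<not> y \<le> x"

instance
proof
  have lin: "Linear_order (cardSuc natLeq)"
    using Well_order_cardSuc_natLeq by (simp add: well_order_on_def)
  fix x y z :: omega1
  show "x < y \<longleftrightarrow> x \<le> y \<and> \<not> y \<le> x" by (rule less_omega1_def)
  show "x \<le> x"
    using lin rep_omega1[of x]
    by (auto simp: less_eq_omega1_def order_on_defs refl_on_def)
  show "x \<le> y \<Longrightarrow> y \<le> z \<Longrightarrow> x \<le> z"
    using lin unfolding less_eq_omega1_def order_on_defs by (blast dest: transD)
  show "x \<le> y \<Longrightarrow> y \<le> x \<Longrightarrow> x = y"
    using lin unfolding less_eq_omega1_def order_on_defs
    by (metis antisymD rep_omega1_inject)
  show "x \<le> y \<or> y \<le> x"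
    using lin rep_omega1[of x] rep_omega1[of y]
    unfolding less_eq_omega1_def order_on_defs total_on_def refl_on_def
    by metis
qed

end

instance omega1 :: wellorder
proof
  fix P :: "omega1 \<Rightarrow> bool" and a :: omega1
  assume step: "\<And>x. (\<And>y. y < x \<Longrightarrow> P y) \<Longrightarrow> P x"
  have "wf (cardSuc natLeq - Id)"
    using Well_order_cardSuc_natLeq by (simp add: well_order_on_def)
  then have "wf (inv_image (cardSuc natLeq - Id) rep_omega1)" by (rule wf_inv_image)
  moreover have "inv_image (cardSuc natLeq - Id) rep_omega1 = {(x, y). x < y}"
    by (auto simp: inv_image_def less_le less_eq_omega1_def rep_omega1_inject)
  ultimately have "wf {(x, y :: omega1). x < y}" by simp
  then show "P a" by (induction a rule: wf_induct_rule) (auto intro: step)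
qed

datatype omega1_closed = Below omega1 | Omega1

instantiation omega1_closed :: linorder
begin

fun less_eq_omega1_closed :: "omega1_closed \<Rightarrow> omega1_closed \<Rightarrow> bool" where
  "Below x \<le> Below y \<longleftrightarrow> x \<le> y"
| "Below x \<le> Omega1 \<longleftrightarrow> True"
| "Omega1 \<le> Below y \<longleftrightarrow> False"
| "Omega1 \<le> Omega1 \<longleftrightarrow> True"

definition less_omega1_closed :: "omega1_closed \<Rightarrow> omega1_closed \<Rightarrow> bool"
  where "less_omega1_closed x y \<longleftrightarrow> x \<le> y \<and> \<not> y \<le> x"

instance
proof
  fix x y z :: omega1_closed
  show "x < y \<longleftrightarrow> x \<le> y \<and> \<not> y \<le> x" by (rule less_omega1_closed_def)
  show "x \<le> x" by (cases x) auto
  show "x \<le> y \<Longrightarrow> y \<le> z \<Longrightarrow> x \<le> z" by (cases x; cases y; cases z) auto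
  show "x \<le> y \<Longrightarrow> y \<le> x \<Longrightarrow> x = y" by (cases x; cases y) auto
  show "x \<le> y \<or> y \<le> x" by (cases x; cases y) auto
qed

end

lemma less_omega1_closed_simps [simp]:
  "Below x < Below y \<longleftrightarrow> x < y" "Below x < Omega1" "\<not> Omega1 < z"
  by (cases z; auto simp: less_omega1_closed_def)+

instance omega1_closed :: wellorder
proof
  fix P :: "omega1_closed \<Rightarrow> bool" and a :: omega1_closed
  assume step: "\<And>x. (\<And>y. y < x \<Longrightarrow> P y) \<Longrightarrow> P x"
  have below: "P (Below x)" for x
  proof (induction x rule: less_induct)
    case (less x)
    have "P y" if "y < Below x" for y
      using that less by (cases y) auto
    then show ?case by (rule step)
  qed
  have "P Omega1"
  proof (rule step)
    fix y assume "y < Omega1"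
    then show "P y" using below by (cases y) auto
  qed
  with below show "P a" by (cases a) auto
qed

instantiation omega1_closed :: "{order_bot, order_top}"
begin

definition bot_omega1_closed :: omega1_closed where "bot_omega1_closed = (LEAST x. True)"

definition top_omega1_closed :: omega1_closed where "top_omega1_closed = Omega1"

instance
proof
  fix x :: omega1_closed
  show "bot \<le> x" by (simp add: bot_omega1_closed_def Least_le)
  show "x \<le> top" by (cases x) (auto simp: top_omega1_closed_def)
qed

end

instantiation omega1_closed :: linorder_topology
begin

definition open_omega1_closed :: "omega1_closed set \<Rightarrow> bool"
  where "open_omega1_closed = generate_topology (range (\<lambda>a. {..<a}) \<union> range (\<lambda>a. {a<..}))"

instance by standard (rule open_omega1_closed_def)

end

text \<open>The order type is indeed $\omega_1 + 1$.\<close>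

lemma countable_lessThan_omega1:
  includes cardinal_syntax
  shows "countable {..<x :: omega1}"
proof -
  let ?r = "cardSuc natLeq"
  have "|underS ?r (rep_omega1 x)| <o ?r"
    by (rule card_of_underS[OF cardSuc_Card_order[OF natLeq_Card_order] rep_omega1])
  then have "|underS ?r (rep_omega1 x)| \<le>o natLeq"
    using cardSuc_ordLess_ordLeq natLeq_Card_order card_of_Card_order
    by (metis cardSuc_ordLeq_ordLess)
  then have "countable (underS ?r (rep_omega1 x))"
    by (simp add: countable_card_le_natLeq)
  moreover have "rep_omega1 ` {..<x} \<subseteq> underS ?r (rep_omega1 x)"
    by (auto simp: underS_def less_le less_eq_omega1_def rep_omega1_inject)
  ultimately have "countable (rep_omega1 ` {..<x})" by (rule countable_subset[rotated])
  moreover have "inj_on rep_omega1 {..<x}" by (simp add: inj_on_def rep_omega1_inject)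
  ultimately show ?thesis by (rule countable_image_inj_on)
qed

lemma uncountable_omega1:
  includes cardinal_syntax
  shows "uncountable (UNIV :: omega1 set)"
proof
  assume "countable (UNIV :: omega1 set)"
  then have "countable (rep_omega1 ` UNIV)" by simp
  moreover have "rep_omega1 ` UNIV = Field (cardSuc natLeq)"
    using type_definition.Rep_range[OF type_definition_omega1] .
  ultimately have "|Field (cardSuc natLeq)| \<le>o natLeq"
    by (simp add: countable_card_le_natLeq)
  moreover have "|Field (cardSuc natLeq)| =o cardSuc natLeq"
    by (rule card_of_Field_ordIso[OF cardSuc_Card_order[OF natLeq_Card_order]])
  ultimately have "cardSuc natLeq \<le>o natLeq"
    using ordIso_ordLeq_trans ordIso_symmetric by blast
  then show False
    using cardSuc_greater[OF natLeq_Card_order] not_ordLess_ordLeq by blast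
qed

lemma countable_lessThan_omega1_closed: "x < top \<Longrightarrow> countable {..<x :: omega1_closed}"
proof (cases x)
  case (Below y)
  have "{..<x} \<subseteq> Below ` {..<y}"
  proof
    fix z assume "z \<in> {..<x}"
    then show "z \<in> Below ` {..<y}" using Below by (cases z) auto
  qed
  then show ?thesis by (rule countable_subset) (simp add: countable_lessThan_omega1)
qed (simp add: top_omega1_closed_def)

lemma uncountable_lessThan_top_omega1_closed: "uncountable {..<top :: omega1_closed}"
proof
  assume "countable {..<top :: omega1_closed}"
  moreover have "range Below \<subseteq> {..<top :: omega1_closed}"
    by (auto simp: top_omega1_closed_def)
  ultimately have "countable (range Below)" by (rule countable_subset[rotated])
  then have "countable (UNIV :: omega1 set)"
    by (rule countable_image_inj_on) (simp add: inj_on_def)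
  then show False using uncountable_omega1 by blast
qed

text \<open>The space is compact, so its bounded continuous functions are all its continuous
  functions, and \<open>omega1_closed \<Rightarrow>\<^sub>C real\<close> with its library norm is $C([0,\omega_1])$.\<close>

lemma compact_atMost_wellorder:
  fixes x :: "'a :: {wellorder, linorder_topology}"
  shows "compact {..x}"
proof (induction x rule: less_induct)
  case (less x)
  show ?case
  proof (rule compactI)
    fix C assume C: "\<forall>U\<in>C. open U" "{..x} \<subseteq> \<Union>C"
    have "x \<in> \<Union>C" using C(2) by blast
    then obtain U where U: "U \<in> C" "x \<in> U" "open U" using C(1) by blast
    show "\<exists>D\<subseteq>C. finite D \<and> {..x} \<subseteq> \<Union>D"
    proof (cases "\<exists>y. y < x")
      case True
      then obtain b where b: "b < x" "{b<..x} \<subseteq> U"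
        using open_left[OF U(3,2)] by blast
      have "{..b} \<subseteq> {..x}" using b(1) by simp
      with C(2) have "{..b} \<subseteq> \<Union>C" by (rule order_trans[rotated])
      with less[OF b(1)] C(1) obtain D where D: "D \<subseteq> C" "finite D" "{..b} \<subseteq> \<Union>D"
        by (metis compactE)
      have "{..x} \<subseteq> {..b} \<union> {b<..x}" by auto
      then have "{..x} \<subseteq> \<Union>(insert U D)" using b(2) D(3) by blast
      with U(1) D show ?thesis
        by (intro exI[of _ "insert U D"]) simp
    next
      case False
      then have "{..x} = {x}" by (auto simp: less_le)
      with U show ?thesis by (intro exI[of _ "{U}"]) auto
    qed
  qed
qed

lemma compact_omega1_closed: "compact (UNIV :: omega1_closed set)"
proof -
  have "(UNIV :: omega1_closed set) = {..top}" by auto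
  then show ?thesis using compact_atMost_wellorder by metis
qed

lemma bcontfun_omega1_closed:
  fixes f :: "omega1_closed \<Rightarrow> real"
  shows "f \<in> bcontfun \<longleftrightarrow> continuous_on UNIV f"
  unfolding bcontfun_def
  using compact_imp_bounded[OF compact_continuous_image[OF _ compact_omega1_closed, of f]] by blast


section \<open>The subspace of monotone functions\<close>

lemma monotone_unit_functions_nonempty:
  "\<exists>f :: omega1_closed \<Rightarrow>\<^sub>C real. antimono (apply_bcontfun f) \<and> f bot = 1 \<and> f top = 0"
proof -
  define f :: "omega1_closed \<Rightarrow> real" where "f = (\<lambda>x. if x = bot then 1 else 0)"
  define s where "s = (LEAST x. bot < (x :: omega1_closed))"
  have bt: "bot < (top :: omega1_closed)"
  proof -
    have "bot \<le> Below undefined" by simp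
    also have "Below undefined < top" by (simp add: top_omega1_closed_def)
    finally show ?thesis .
  qed
  then have "bot < s" unfolding s_def by (rule LeastI)
  moreover have "s \<le> x" if "x \<noteq> bot" for x
    unfolding s_def using that by (simp add: Least_le bot.not_eq_extremum)
  ultimately have eq: "{bot} = {..<s}"
    by (auto simp: not_less[symmetric])
  have "UNIV = {bot} \<union> {bot :: omega1_closed<..}"
    by (auto simp: less_le)
  moreover have "continuous_on ({bot} \<union> {bot<..}) f"
  proof (rule continuous_on_open_Un)
    show "open {bot :: omega1_closed}" unfolding eq by simp
    show "continuous_on {bot<..} f"
      by (rule continuous_on_eq[OF continuous_on_const[of _ 0]]) (auto simp: f_def)
  qed auto
  ultimately have "f \<in> bcontfun" by (simp add: bcontfun_omega1_closed)
  then have "apply_bcontfun (Bcontfun f) = f" by (rule Bcontfun_inverse)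
  moreover have "antimono f"
    by (auto simp: f_def antimono_def bot_unique)
  ultimately show ?thesis
    using bt by (intro exI[of _ "Bcontfun f"]) (simp add: f_def)
qed

typedef M_omega1 =
  "{f :: omega1_closed \<Rightarrow>\<^sub>C real. antimono (apply_bcontfun f) \<and> f bot = 1 \<and> f top = 0}"
  morphisms fun_of_M M_of_fun
  using monotone_unit_functions_nonempty by simp

instantiation M_omega1 :: metric_space
begin

definition dist_M_omega1 :: "M_omega1 \<Rightarrow> M_omega1 \<Rightarrow> real"
  where "dist_M_omega1 f g = dist (fun_of_M f) (fun_of_M g)"

definition uniformity_M_omega1 :: "(M_omega1 \<times> M_omega1) filter"
  where "uniformity_M_omega1 = (INF e\<in>{0<..}. principal {(f, g). dist f g < e})"

definition open_M_omega1 :: "M_omega1 set \<Rightarrow> bool"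
  where "open_M_omega1 S = (\<forall>f\<in>S. \<forall>\<^sub>F (f', g) in uniformity. f' = f \<longrightarrow> g \<in> S)"

instance
proof
  fix f g h :: M_omega1
  show "dist f g = 0 \<longleftrightarrow> f = g" by (simp add: dist_M_omega1_def fun_of_M_inject)
  show "dist f g \<le> dist f h + dist g h" unfolding dist_M_omega1_def by (rule dist_triangle2)
qed (rule uniformity_M_omega1_def open_M_omega1_def)+

end


section \<open>The separable modification of a uniform space\<close>

definition uniformly_continuous_into_metric ::
    "'b metric \<Rightarrow> ('a :: uniform_space \<Rightarrow> 'b) \<Rightarrow> bool"
  where "uniformly_continuous_into_metric m f \<longleftrightarrow>
    range f \<subseteq> mspace m \<and> (\<forall>e>0. \<forall>\<^sub>F (x, y) in uniformity. mdist m (f x) (f y) < e)"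

text \<open>A type carries a single uniformity, so the separable modification lives on a copy of the
  type of points.\<close>

typedef 'a separable_modification = "UNIV :: 'a set"
  morphisms point_of_p1 p1_of_point ..

text \<open>One cannot quantify over all types of points of metric spaces. A separable metric space has at
  most continuum many points, so it is isometric to a metric space whose set of points is a
  set of reals; this justifies the restriction to \<open>real metric\<close> below, see the lemma
  \<open>uniformly_continuous_p1_separable\<close> for metric spaces over arbitrary types.\<close>

instantiation separable_modification :: (uniform_space) uniform_space
begin

definition uniformity_separable_modification ::
    "('a separable_modification \<times> 'a separable_modification) filter"
  where "uniformity_separable_modification =
    (INF (m, f, e) \<in> {(m :: real metric, f :: 'a \<Rightarrow> real, e :: real).
        separable_space (mtopology_of m) \<and> uniformly_continuous_into_metric m f \<and> e > 0}.
      principal {(x, y). mdist m (f (point_of_p1 x)) (f (point_of_p1 y)) < e})"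

definition open_separable_modification :: "'a separable_modification set \<Rightarrow> bool"
  where "open_separable_modification S =
    (\<forall>x\<in>S. \<forall>\<^sub>F (x', y) in uniformity. x' = x \<longrightarrow> y \<in> S)"

instance
proof
  define G where "G = {(m :: real metric, f :: 'a \<Rightarrow> real, e :: real).
        separable_space (mtopology_of m) \<and> uniformly_continuous_into_metric m f \<and> e > 0}"
  define P :: "real metric \<times> ('a \<Rightarrow> real) \<times> real
      \<Rightarrow> ('a separable_modification \<times> 'a separable_modification) set"
    where "P = (\<lambda>(m, f, e). {(x, y). mdist m (f (point_of_p1 x)) (f (point_of_p1 y)) < e})"
  have U_eq: "uniformity = (INF g\<in>G. principal (P g))"
    unfolding uniformity_separable_modification_def G_def[symmetric]
    by (rule INF_cong) (auto simp: P_def)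
  have ev: "eventually E (INF g\<in>X. principal (P g)) \<longleftrightarrow> (\<forall>p. (\<forall>g\<in>X. p \<in> P g) \<longrightarrow> E p)"
    if "finite X" for E X
    unfolding INF_principal_finite[OF that, of P] eventually_principal by blast
  have U: "eventually E uniformity \<longleftrightarrow>
      (\<exists>X\<subseteq>G. finite X \<and> (\<forall>p. (\<forall>g\<in>X. p \<in> P g) \<longrightarrow> E p))" for E
    unfolding U_eq
    by (rule trans[OF eventually_INF], rule ex_cong1, rule conj_cong[OF refl], rule conj_cong[OF refl], rule ev)
  have mem: "f a \<in> mspace m" if "(m, f, e) \<in> G" for m f e a
    using that by (auto simp: G_def uniformly_continuous_into_metric_def)
  fix E :: "'a separable_modification \<times> 'a separable_modification \<Rightarrow> bool"
  show "E (x, x)" if E: "eventually E uniformity" for x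
  proof -
    from E obtain X where X: "X \<subseteq> G" "\<And>p. (\<forall>g\<in>X. p \<in> P g) \<Longrightarrow> E p" unfolding U by blast
    have "(x, x) \<in> P g" if "g \<in> X" for g
    proof -
      obtain m f e where g: "g = (m, f, e)" by (cases g)
      with that X have "(m, f, e) \<in> G" by blast
      with mem[OF this] show ?thesis
        by (auto simp: g P_def G_def Metric_space.mdist_zero[OF Metric_space_mspace_mdist])
    qed
    with X show ?thesis by blast
  qed
  show "\<forall>\<^sub>F (x, y) in uniformity. E (y, x)" if E: "eventually E uniformity"
  proof -
    from E obtain X where X: "X \<subseteq> G" "finite X" "\<And>p. (\<forall>g\<in>X. p \<in> P g) \<Longrightarrow> E p"
      unfolding U by blast
    have "E (y, x)" if "\<forall>g\<in>X. (x, y) \<in> P g" for x y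
      using that by (intro X(3)) (auto simp: P_def mdist_commute)
    then have "\<forall>p. (\<forall>g\<in>X. p \<in> P g) \<longrightarrow> (case p of (x, y) \<Rightarrow> E (y, x))" by auto
    with X(1,2) show ?thesis unfolding U by blast
  qed
  show "\<exists>D. eventually D uniformity \<and> (\<forall>x y z. D (x, y) \<longrightarrow> D (y, z) \<longrightarrow> E (x, z))"
    if E: "eventually E uniformity"
  proof -
    from E obtain X where X: "X \<subseteq> G" "finite X" "\<And>p. (\<forall>g\<in>X. p \<in> P g) \<Longrightarrow> E p"
      unfolding U by blast
    define Y where "Y = (\<lambda>(m, f, e). (m, f, e / 2)) ` X"
    define D where "D = (\<lambda>p. \<forall>g\<in>Y. p \<in> P g)"
    have "Y \<subseteq> G" "finite Y" using X(1,2) by (auto simp: Y_def G_def)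
    then have "eventually D uniformity" unfolding U D_def by blast
    moreover have "E (x, z)" if D: "D (x, y)" "D (y, z)" for x y z
    proof (rule X(3), rule ballI)
      fix g assume "g \<in> X"
      obtain m f e where g: "g = (m, f, e)" by (cases g)
      have G: "(m, f, e) \<in> G" using \<open>g \<in> X\<close> X(1) g by blast
      have "(m, f, e / 2) \<in> Y" using \<open>g \<in> X\<close> g by (force simp: Y_def)
      with D have "mdist m (f (point_of_p1 x)) (f (point_of_p1 y)) < e / 2"
        "mdist m (f (point_of_p1 y)) (f (point_of_p1 z)) < e / 2"
        by (auto simp: D_def P_def)
      with mdist_triangle[OF mem[OF G] mem[OF G] mem[OF G],
          of "point_of_p1 x" "point_of_p1 z" "point_of_p1 y"]
      show "(x, z) \<in> P g" by (simp add: g P_def)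
    qed
    ultimately show ?thesis by blast
  qed
qed (rule open_separable_modification_def)

end

lemma separable_metric_lepoll_real:
  assumes "separable_space (mtopology_of m)"
  shows "mspace m \<lesssim> (UNIV :: real set)"
proof -
  interpret Metric_space "mspace m" "mdist m" by simp
  from assms obtain C where C: "countable C" "C \<subseteq> mspace m"
      "mtopology_of m closure_of C = mspace m"
    by (auto simp: separable_space_def)
  define h where "h = (\<lambda>x. {to_nat (to_nat_on C c, k) | c k.
      c \<in> C \<and> mdist m x c < inverse (real (Suc k))})"
  have "inj_on h (mspace m)"
  proof (rule inj_onI, rule ccontr)
    fix x y assume xy: "x \<in> mspace m" "y \<in> mspace m" "h x = h y" "x \<noteq> y"
    then have "mdist m x y > 0" by simp
    then obtain k where k: "inverse (real (Suc k)) < mdist m x y / 2"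
      using reals_Archimedean[of "mdist m x y / 2"] by auto
    have "x \<in> mtopology closure_of C" using C(3) xy(1) by (simp add: mtopology_of_def)
    then obtain c where c: "c \<in> C" "mdist m x c < inverse (real (Suc k))"
      unfolding metric_closure_of
      by (smt (verit, best) in_mball inverse_positive_iff_positive mem_Collect_eq of_nat_0_less_iff
          zero_less_Suc)
    then have "to_nat (to_nat_on C c, k) \<in> h x" by (auto simp: h_def)
    with xy(3) have "to_nat (to_nat_on C c, k) \<in> h y" by simp
    then obtain c' where "c' \<in> C" "to_nat_on C c' = to_nat_on C c"
        "mdist m y c' < inverse (real (Suc k))"
      by (auto simp: h_def)
    with C(1) c have "mdist m y c < inverse (real (Suc k))" by simp
    with c k C(2) xy triangle[of x c y] commute[of c y] show False by auto
  qed
  then have "mspace m \<lesssim> (UNIV :: nat set set)" unfolding lepoll_def by blast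
  then show ?thesis using nat_sets_eqpoll_reals lepoll_trans2 by blast
qed

lemma uniformly_continuous_p1_separable:
  fixes m :: "'b metric" and f :: "'a :: uniform_space \<Rightarrow> 'b"
  assumes sep: "separable_space (mtopology_of m)"
    and f: "uniformly_continuous_into_metric m f"
  shows "uniformly_continuous_into_metric m (\<lambda>x. f (point_of_p1 x))"
proof -
  from separable_metric_lepoll_real[OF sep] obtain h :: "'b \<Rightarrow> real"
    where h: "inj_on h (mspace m)" unfolding lepoll_def by blast
  define k where "k = inv_into (mspace m) h"
  have k: "k (h x) = x" if "x \<in> mspace m" for x
    using h that by (simp add: k_def)
  define m' where "m' = metric (h ` mspace m, \<lambda>a b. mdist m (k a) (k b))"
  have M': "Metric_space (h ` mspace m) (\<lambda>a b. mdist m (k a) (k b))"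
    by unfold_locales (auto simp: k mdist_commute intro: mdist_triangle)
  have m': "mspace m' = h ` mspace m" "mdist m' = (\<lambda>a b. mdist m (k a) (k b))"
    unfolding m'_def
    by (simp_all add: Metric_space.mspace_metric[OF M'] Metric_space.mdist_metric[OF M'])
  have "uniformly_continuous_map m m' h"
    unfolding uniformly_continuous_map_def m' by (auto simp: k)
  then have "continuous_map (mtopology_of m) (mtopology_of m') h"
    by (rule uniformly_continuous_imp_continuous_map)
  then have sep': "separable_space (mtopology_of m')"
    by (rule separable_space_continuous_map_image[OF sep]) (simp add: m')
  have mem: "f x \<in> mspace m" for x
    using f by (auto simp: uniformly_continuous_into_metric_def)
  have f': "uniformly_continuous_into_metric m' (\<lambda>x. h (f x))"
    using f by (auto simp: uniformly_continuous_into_metric_def m' k mem)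
  have "\<forall>\<^sub>F (x, y) in uniformity. mdist m (f (point_of_p1 x)) (f (point_of_p1 y)) < e" if "e > 0" for e
    unfolding uniformity_separable_modification_def
    by (rule eventually_INF1[of "(m', \<lambda>x. h (f x), e)"])
      (use sep' f' that in \<open>auto simp: eventually_principal m' k mem\<close>)
  then show ?thesis
    using mem by (auto simp: uniformly_continuous_into_metric_def)
qed

end

theory Submission
  imports Defs
begin

text \<open>
  For countable ordinals $\beta_0 < \dots < \beta_{n-1}$ consider the average of the characteristic
  functions of the intervals $[0,\beta_i]$. It belongs to $\mathsf{M}$, and two such averages are at
  distance at most $1/n$ as soon as the tuples interlace:
  $\beta_i \le \alpha_i \le \beta_{i+1}$. Given a uniformly continuous map into a separable metric
  space, colour the $n$-tuples by countably many small balls covering that space. Since countable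
  unions of countable sets are countable, one colour is taken on a tree of tuples in which every node
  has uncountably many successors, and every $\beta$ that grows fast enough interlaces with a branch
  of this tree. Hence the map is almost constant on the averages over fast tuples, i.e. these
  averages form a Cauchy filter of the separable modification. A limit would have to be $1$ on
  all of $[0,\omega_1)$ and $0$ at $\omega_1$, so it would not be continuous.
\<close>

section \<open>Boundedness in the countable ordinals\<close>

lemma countable_bounded_omega1:
  assumes "countable (A :: omega1 set)"
  shows "\<exists>b. \<forall>a\<in>A. a < b"
proof (rule ccontr)
  assume "\<not> ?thesis"
  then have "UNIV = (\<Union>a\<in>A. insert a {..<a})" by (auto simp: not_less le_less)
  moreover have "countable (\<Union>a\<in>A. insert a {..<a})"
    using assms by (intro countable_UN) (auto simp: countable_lessThan_omega1)
  ultimately show False using uncountable_omega1 by metis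
qed

lemma uncountable_unbounded_omega1:
  assumes "uncountable (S :: omega1 set)"
  shows "\<exists>a\<in>S. x < a"
proof (rule ccontr)
  assume "\<not> ?thesis"
  then have "S \<subseteq> insert x {..<x}" by (auto simp: not_less le_less)
  moreover have "countable (insert x {..<x})" by (simp add: countable_lessThan_omega1)
  ultimately show False using assms countable_subset by blast
qed

section \<open>Large sets of tuples\<close>

text \<open>The recursion spells out an iterated quantifier ``for uncountably many \<open>a\<^sub>1\<close>, \dots, for uncountably
  many \<open>a\<^sub>n\<close>''; its sections form the tree of monochromatic tuples.\<close>

fun large :: "nat \<Rightarrow> (omega1 list \<Rightarrow> bool) \<Rightarrow> bool" where
  "large 0 P \<longleftrightarrow> P []"
| "large (Suc n) P \<longleftrightarrow> uncountable {a. large n (\<lambda>l. P (a # l))}"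

text \<open>Pigeonhole at every level of the tree: each first entry gets a colour by induction, and
  countably many colours cannot all be used by only countably many first entries.\<close>

lemma large_countable_partition:
  assumes "\<And>l. \<exists>c::nat. P c l"
  shows "\<exists>c. large n (P c)"
  using assms
proof (induction n arbitrary: P)
  case (Suc n)
  have "\<exists>c. large n (\<lambda>l. P c (a # l))" for a
    using Suc.IH[of "\<lambda>c l. P c (a # l)"] Suc.prems by blast
  then have "UNIV = (\<Union>c. {a. large n (\<lambda>l. P c (a # l))})" by auto
  then have "\<exists>c. uncountable {a. large n (\<lambda>l. P c (a # l))}"
    using uncountable_omega1 countable_UN[of UNIV "\<lambda>c. {a. large n (\<lambda>l. P c (a # l))}"] by auto
  then show ?case by simp
qed auto

text \<open>Monotonicity is demanded separately because \<open>h\<close> is arbitrary and may take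
  values below its argument. The sequence is infinite so that one sequence serves averages of every
  length.\<close>

definition fast :: "(omega1 \<Rightarrow> omega1) \<Rightarrow> (nat \<Rightarrow> omega1) \<Rightarrow> bool" where
  "fast h \<beta> \<longleftrightarrow> strict_mono \<beta> \<and> (\<forall>i. h (\<beta> i) < \<beta> (Suc i))"

lemma fast_exists: "\<exists>\<beta>. fast h \<beta>"
proof -
  have "\<exists>y. x < y \<and> h x < y" for x
    using countable_bounded_omega1[of "{x, h x}"] by auto
  then obtain s where s: "\<And>x. x < s x \<and> h x < s x" by metis
  define \<beta> where "\<beta> = rec_nat undefined (\<lambda>_. s)"
  have "\<beta> (Suc i) = s (\<beta> i)" for i by (simp add: \<beta>_def)
  then have "fast h \<beta>" using s by (simp add: fast_def strict_mono_Suc_iff)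
  then show ?thesis by blast
qed

lemma fast_mono:
  assumes "fast h \<beta>" "\<And>x. h' x \<le> h x"
  shows "fast h' \<beta>"
  using assms unfolding fast_def by (meson le_less_trans)

text \<open>One step of \<open>\<beta>\<close> already clears \<open>h\<close>, and
  \<open>m > 0\<close> steps go at least as far. This serves to compare an average of length
  \<open>n * m\<close> with one of length \<open>n\<close>.\<close>

lemma fast_subsequence:
  assumes \<beta>: "fast h \<beta>" and "m > 0"
  shows "fast h (\<lambda>i. \<beta> (i * m))"
proof -
  have mono: "strict_mono \<beta>" and h: "\<And>i. h (\<beta> i) < \<beta> (Suc i)"
    using \<beta> by (auto simp: fast_def)
  have "strict_mono (\<lambda>i. \<beta> (i * m))"
    using \<open>m > 0\<close> by (auto simp: strict_mono_def intro: strict_monoD[OF mono])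
  moreover have "h (\<beta> (i * m)) < \<beta> (Suc i * m)" for i
  proof -
    have "\<beta> (Suc (i * m)) \<le> \<beta> (Suc i * m)"
      using \<open>m > 0\<close> by (intro strict_mono_leD[OF mono]) auto
    with h[of "i * m"] show ?thesis by simp
  qed
  ultimately show ?thesis by (simp add: fast_def)
qed

text \<open>The branch is built entry by entry: the first entry is placed between
  \<open>\<beta> 0\<close> and \<open>\<beta> 1\<close>, and the induction hypothesis for its
  section is applied to the shifted sequence.\<close>

lemma large_interlaced:
  assumes "large n P"
  shows "\<exists>h. \<forall>\<beta>. fast h \<beta> \<longrightarrow>
    (\<exists>l. length l = n \<and> P l \<and> (\<forall>i<n. \<beta> i \<le> l ! i \<and> l ! i \<le> \<beta> (Suc i)))"
  using assms
proof (induction n arbitrary: P)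
  case 0
  then show ?case by auto
next
  case (Suc n)
  define S where "S = {a. large n (\<lambda>l. P (a # l))}"
  have S: "uncountable S" using Suc.prems by (simp add: S_def)
  have "\<forall>a\<in>S. \<exists>h. \<forall>\<beta>. fast h \<beta> \<longrightarrow>
      (\<exists>l. length l = n \<and> P (a # l) \<and> (\<forall>i<n. \<beta> i \<le> l ! i \<and> l ! i \<le> \<beta> (Suc i)))"
    unfolding S_def by (auto intro: Suc.IH)
  from bchoice[OF this] obtain H where H: "\<And>a \<beta>. a \<in> S \<Longrightarrow> fast (H a) \<beta> \<Longrightarrow>
      \<exists>l. length l = n \<and> P (a # l) \<and> (\<forall>i<n. \<beta> i \<le> l ! i \<and> l ! i \<le> \<beta> (Suc i))"
    by blast
  obtain s where s: "\<And>x. s x \<in> S" "\<And>x. x < s x"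
    using uncountable_unbounded_omega1[OF S] by metis
  have "\<exists>b. \<forall>y \<in> insert (s x) ((\<lambda>a. H a x) ` (insert x {..<x})). y < b" for x
    by (rule countable_bounded_omega1) (simp add: countable_lessThan_omega1)
  \<comment> \<open>The first entry \<open>a\<close> of the branch depends on \<open>\<beta>\<close>, so \<open>h\<close> has to dominate, at each \<open>x\<close>,
    the bounds for all of the countably many \<open>a \<le> x\<close>.\<close>
  then obtain h where "\<And>x. \<forall>y \<in> insert (s x) ((\<lambda>a. H a x) ` (insert x {..<x})). y < h x"
    by metis
  then have h: "\<And>x. s x < h x" "\<And>a x. a \<le> x \<Longrightarrow> H a x < h x"
    by (auto simp: le_less)
  show ?case
  proof (intro exI[of _ h] allI impI)
    fix \<beta> assume \<beta>: "fast h \<beta>"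
    then have mono: "strict_mono \<beta>" and h\<beta>: "\<And>i. h (\<beta> i) < \<beta> (Suc i)"
      by (auto simp: fast_def)
    \<comment> \<open>This choice lies above \<open>\<beta> 0\<close> by the choice of
      \<open>s\<close>, and below \<open>\<beta> 1\<close> because \<open>h\<close> dominates
      \<open>s\<close>.\<close>
    define a where "a = s (\<beta> 0)"
    have a: "a \<in> S" "\<beta> 0 < a" "a < \<beta> (Suc 0)"
      using s h(1)[of "\<beta> 0"] h\<beta>[of 0] by (auto simp: a_def)
    have "fast (H a) (\<lambda>i. \<beta> (Suc i))"
      unfolding fast_def
    proof (intro conjI allI)
      show "strict_mono (\<lambda>i. \<beta> (Suc i))" using mono by (simp add: strict_mono_Suc_iff)
      fix i
      \<comment> \<open>So \<open>a\<close> lies below every term of the shifted sequence, which is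
        where \<open>h\<close> dominates \<open>H a\<close>.\<close>
      have "\<beta> (Suc 0) \<le> \<beta> (Suc i)" by (intro strict_mono_leD[OF mono]) simp
      with a(3) have "H a (\<beta> (Suc i)) < h (\<beta> (Suc i))" by (intro h(2)) simp
      with h\<beta> show "H a (\<beta> (Suc i)) < \<beta> (Suc (Suc i))" by (meson less_trans)
    qed
    from H[OF a(1) this] obtain l where l: "length l = n" "P (a # l)"
      "\<forall>i<n. \<beta> (Suc i) \<le> l ! i \<and> l ! i \<le> \<beta> (Suc (Suc i))" by blast
    have "\<forall>i<Suc n. \<beta> i \<le> (a # l) ! i \<and> (a # l) ! i \<le> \<beta> (Suc i)"
      using l(3) a by (auto simp: less_Suc_eq_0_disj)
    with l show "\<exists>l. length l = Suc n \<and> P l \<and> (\<forall>i<Suc n. \<beta> i \<le> l ! i \<and> l ! i \<le> \<beta> (Suc i))"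
      by (intro exI[of _ "a # l"]) simp
  qed
qed

section \<open>Averages of characteristic functions\<close>

text \<open>Only the first \<open>n\<close> terms matter. For \<open>n = 0\<close> division by zero
  gives the zero function, which is not in \<open>M\<close>; hence the later assumptions
  \<open>n > 0\<close>.\<close>

definition step_fun :: "nat \<Rightarrow> (nat \<Rightarrow> omega1) \<Rightarrow> omega1_closed \<Rightarrow> real" where
  "step_fun n \<alpha> x = (\<Sum>i<n. of_bool (x \<le> Below (\<alpha> i))) / real n"

definition step_bcontfun :: "nat \<Rightarrow> (nat \<Rightarrow> omega1) \<Rightarrow> omega1_closed \<Rightarrow>\<^sub>C real" where
  "step_bcontfun n \<alpha> = Bcontfun (step_fun n \<alpha>)"

text \<open>A point below the top has an immediate successor \<open>s\<close>, so its closed initial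
  segment is the open ray below \<open>s\<close>.\<close>

lemma open_atMost_Below: "open {..Below a}"
proof -
  define s where "s = (LEAST x. Below a < x)"
  have "Below a < s" unfolding s_def by (rule LeastI[of _ Omega1]) simp
  moreover have "s \<le> x" if "Below a < x" for x
    unfolding s_def using that by (rule Least_le)
  ultimately have "{..Below a} = {..<s}"
    by (auto simp: not_less[symmetric])
  then show ?thesis by simp
qed

lemma continuous_indicator_atMost_Below:
  "continuous_on UNIV (\<lambda>x. of_bool (x \<le> Below a) :: real)"
proof -
  have "continuous_on ({..Below a} \<union> {Below a<..}) (\<lambda>x. of_bool (x \<le> Below a) :: real)"
  proof (rule continuous_on_open_Un)
    show "continuous_on {..Below a} (\<lambda>x. of_bool (x \<le> Below a) :: real)"
      by (rule continuous_on_eq[OF continuous_on_const[of _ 1]]) auto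
    show "continuous_on {Below a<..} (\<lambda>x. of_bool (x \<le> Below a) :: real)"
      by (rule continuous_on_eq[OF continuous_on_const[of _ 0]]) auto
  qed (auto simp: open_atMost_Below)
  moreover have "{..Below a} \<union> {Below a<..} = UNIV" by auto
  ultimately show ?thesis by simp
qed

lemma apply_step_bcontfun [simp]: "apply_bcontfun (step_bcontfun n \<alpha>) = step_fun n \<alpha>"
proof -
  have "continuous_on UNIV (step_fun n \<alpha>)"
    unfolding step_fun_def[abs_def] divide_inverse
    by (intro continuous_intros continuous_indicator_atMost_Below)
  then show ?thesis
    by (simp add: step_bcontfun_def bcontfun_omega1_closed Bcontfun_inverse)
qed

lemma step_bcontfun_in_M:
  assumes "n > 0"
  shows "antimono (apply_bcontfun (step_bcontfun n \<alpha>))"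
    and "step_bcontfun n \<alpha> bot = 1"
    and "step_bcontfun n \<alpha> top = 0"
proof -
  show "antimono (apply_bcontfun (step_bcontfun n \<alpha>))"
  proof (rule antimonoI)
    fix x y :: omega1_closed assume "x \<le> y"
    then have "of_bool (y \<le> Below a) \<le> (of_bool (x \<le> Below a) :: real)" for a
      by (auto split: split_of_bool)
    then show "step_bcontfun n \<alpha> y \<le> step_bcontfun n \<alpha> x"
      unfolding apply_step_bcontfun step_fun_def by (intro divide_right_mono sum_mono) auto
  qed
  show "step_bcontfun n \<alpha> bot = 1" using assms by (simp add: step_fun_def)
  show "step_bcontfun n \<alpha> top = 0" by (simp add: step_fun_def top_omega1_closed_def)
qed

text \<open>The sum of \<open>b\<close> is squeezed between the sum of \<open>a\<close> and its
  shift, and these differ by the telescoping \<open>a n - a 0\<close>, at most 1.\<close>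

lemma mean_interlaced:
  fixes a b :: "nat \<Rightarrow> real"
  assumes ab: "\<And>i. i < n \<Longrightarrow> a i \<le> b i \<and> b i \<le> a (Suc i)" and a: "0 \<le> a 0" "a n \<le> 1"
  shows "\<bar>(\<Sum>i<n. a i) / real n - (\<Sum>i<n. b i) / real n\<bar> \<le> 1 / real n"
proof -
  have "(\<Sum>i<n. a i) \<le> (\<Sum>i<n. b i)" using ab by (intro sum_mono) auto
  moreover have "(\<Sum>i<n. b i) \<le> (\<Sum>i<n. a (Suc i))" using ab by (intro sum_mono) auto
  moreover have "(\<Sum>i<n. a (Suc i)) - (\<Sum>i<n. a i) = a n - a 0"
    using sum_lessThan_telescope[of a n] by (simp add: sum_subtractf)
  ultimately have "\<bar>(\<Sum>i<n. a i) - (\<Sum>i<n. b i)\<bar> \<le> 1" using a by linarith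
  then have "\<bar>(\<Sum>i<n. a i) - (\<Sum>i<n. b i)\<bar> / real n \<le> 1 / real n" by (rule divide_right_mono) simp
  then show ?thesis by (simp add: diff_divide_distrib[symmetric])
qed

lemma dist_step_interlaced:
  assumes "\<And>i. i < n \<Longrightarrow> \<beta> i \<le> \<alpha> i \<and> \<alpha> i \<le> \<beta> (Suc i)"
  shows "dist (step_bcontfun n \<beta>) (step_bcontfun n \<alpha>) \<le> 1 / real n"
proof (rule dist_bound)
  fix x
  have le: "x \<le> Below b" if "x \<le> Below a" "a \<le> b" for a b
    using that by (meson less_eq_omega1_closed.simps(1) order_trans)
  show "dist (step_bcontfun n \<beta> x) (step_bcontfun n \<alpha> x) \<le> 1 / real n"
    unfolding apply_step_bcontfun step_fun_def dist_real_def
    by (rule mean_interlaced) (use assms le in \<open>auto split: split_of_bool\<close>)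
qed

lemma dist_step_subsequence:
  assumes mono: "strict_mono \<gamma>" and "m > 0"
  shows "dist (step_bcontfun n (\<lambda>i. \<gamma> (i * m))) (step_bcontfun (n * m) \<gamma>) \<le> 1 / real n"
proof (rule dist_bound)
  fix x
  define g :: "nat \<Rightarrow> real" where "g i = of_bool (x \<le> Below (\<gamma> i))" for i
  have g: "g i \<le> g j" if "i \<le> j" for i j
    using strict_mono_leD[OF mono that]
    by (auto simp: g_def split: split_of_bool)
       (meson less_eq_omega1_closed.simps(1) order_trans)
  \<comment> \<open>Cut the \<open>n * m\<close> terms into \<open>n\<close> blocks of length
    \<open>m\<close>. The mean of a block lies between its first term and the first term of the next
    block, so the block means interlace with the subsequence.\<close>
  define b where "b i = (\<Sum>l\<in>{i * m..<i * m + m}. g l) / real m" for i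
  have b: "g (i * m) \<le> b i \<and> b i \<le> g (Suc i * m)" for i
  proof -
    have "(\<Sum>l\<in>{i * m..<i * m + m}. g (i * m)) \<le> (\<Sum>l\<in>{i * m..<i * m + m}. g l)"
      by (intro sum_mono g) auto
    moreover have "(\<Sum>l\<in>{i * m..<i * m + m}. g l) \<le> (\<Sum>l\<in>{i * m..<i * m + m}. g (Suc i * m))"
      by (intro sum_mono g) auto
    ultimately show ?thesis
      using \<open>m > 0\<close> by (simp add: b_def field_simps)
  qed
  have "(\<Sum>i<n. b i) / real n = (\<Sum>i<n*m. g i) / real (n * m)"
    unfolding b_def sum_divide_distrib[symmetric] sum.nat_group by (simp add: field_simps)
  moreover have "\<bar>(\<Sum>i<n. g (i * m)) / real n - (\<Sum>i<n. b i) / real n\<bar> \<le> 1 / real n"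
    using b by (intro mean_interlaced) (auto simp: g_def)
  ultimately show "dist (step_bcontfun n (\<lambda>i. \<gamma> (i * m)) x) (step_bcontfun (n * m) \<gamma> x) \<le> 1 / real n"
    by (simp add: step_fun_def dist_real_def g_def)
qed

section \<open>A Cauchy filter without limit\<close>

lemma uniformly_continuous_into_metricE:
  fixes f :: "'a :: metric_space \<Rightarrow> 'b"
  assumes "uniformly_continuous_into_metric m f" "e > 0"
  obtains d where "d > 0" "\<And>x y. dist x y < d \<Longrightarrow> mdist m (f x) (f y) < e"
  using assms unfolding uniformly_continuous_into_metric_def eventually_uniformity_metric by auto

text \<open>Enumerates a countable dense set. Membership of \<open>d k\<close> is claimed only for
  the centre found, since no enumeration stays inside an empty space.\<close>

lemma separable_metric_countable_cover:
  assumes sep: "separable_space (mtopology_of m)" and "e > 0"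
  obtains d :: "nat \<Rightarrow> 'b"
  where "\<And>y. y \<in> mspace m \<Longrightarrow> \<exists>k. d k \<in> mspace m \<and> mdist m y (d k) < e"
proof -
  interpret Metric_space "mspace m" "mdist m" by simp
  from sep obtain C where C: "countable C" "C \<subseteq> mspace m"
      "mtopology_of m closure_of C = mspace m"
    by (auto simp: separable_space_def)
  have "\<exists>k. from_nat_into C k \<in> mspace m \<and> mdist m y (from_nat_into C k) < e" if y: "y \<in> mspace m" for y
  proof -
    have "y \<in> mtopology closure_of C" using C(3) y by (simp add: mtopology_of_def)
    then obtain c where c: "c \<in> C" "mdist m y c < e"
      unfolding metric_closure_of using \<open>e > 0\<close> by (auto simp: in_mball)
    moreover obtain k where "from_nat_into C k = c"
      using from_nat_into_surj[OF C(1) c(1)] by blast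
    ultimately show ?thesis using C(2) by blast
  qed
  then show thesis by (rule that)
qed

text \<open>A long average is near its coarse subsequence average, that one is near an average of
  the fixed colour, and the value there is near the centre \<open>d c\<close>. The abstract
  \<open>pt\<close> covers \<open>M\<close> and the whole function space alike.\<close>

lemma uniformly_continuous_almost_constant:
  fixes pt :: "nat \<Rightarrow> (nat \<Rightarrow> omega1) \<Rightarrow> 'a :: metric_space" and f :: "'a \<Rightarrow> 'b"
  assumes pt: "\<And>n k \<alpha> \<beta>. n > 0 \<Longrightarrow> k > 0 \<Longrightarrow>
      dist (pt n \<alpha>) (pt k \<beta>) = dist (step_bcontfun n \<alpha>) (step_bcontfun k \<beta>)"
    and sep: "separable_space (mtopology_of m)"
    and f: "uniformly_continuous_into_metric m f" and "e > 0"
  shows "\<exists>h n. n > 0 \<and> (\<forall>\<beta> \<gamma> k l. fast h \<beta> \<longrightarrow> fast h \<gamma> \<longrightarrow> k > 0 \<longrightarrow> l > 0 \<longrightarrow>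
      mdist m (f (pt (n * k) \<beta>)) (f (pt (n * l) \<gamma>)) < e)"
proof -
  have mem: "f x \<in> mspace m" for x
    using f by (auto simp: uniformly_continuous_into_metric_def)
  \<comment> \<open>Three errors of \<open>e / 6\<close> lead from a value to the centre, and two
    values are compared through the centre.\<close>
  from f obtain \<delta> where "\<delta> > 0" and \<delta>: "\<And>x y. dist x y < \<delta> \<Longrightarrow> mdist m (f x) (f y) < e / 6"
    using uniformly_continuous_into_metricE[of m f "e / 6"] \<open>e > 0\<close> by auto
  obtain N where "inverse (real (Suc N)) < \<delta>" using reals_Archimedean[OF \<open>\<delta> > 0\<close>] by blast
  then obtain n where n: "n > 0" "1 / real n < \<delta>"
    by (metis inverse_eq_divide zero_less_Suc)
  obtain d where d: "\<And>y. y \<in> mspace m \<Longrightarrow> \<exists>k::nat. d k \<in> mspace m \<and> mdist m y (d k) < e / 6"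
    using separable_metric_countable_cover[OF sep, of "e / 6"] \<open>e > 0\<close> by auto
  \<comment> \<open>The colour is the index of a ball containing the value. Lists shorter than
    \<open>n\<close> have unspecified entries, but \<open>large n\<close> tests only lists of length
    \<open>n\<close>.\<close>
  define P where "P c l \<longleftrightarrow> d c \<in> mspace m \<and> mdist m (f (pt n ((!) l))) (d c) < e / 6" for c l
  have "\<exists>c. P c l" for l unfolding P_def using d mem by blast
  then obtain c where "large n (P c)" using large_countable_partition[of P n] by blast
  then obtain h where h: "\<And>\<beta>. fast h \<beta> \<Longrightarrow>
      \<exists>l. P c l \<and> (\<forall>i<n. \<beta> i \<le> l ! i \<and> l ! i \<le> \<beta> (Suc i))"
    using large_interlaced by metis
  have close: "d c \<in> mspace m \<and> mdist m (f (pt (n * k) \<beta>)) (d c) < e / 2"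
    if \<beta>: "fast h \<beta>" and "k > 0" for \<beta> k
  proof -
    let ?\<beta> = "\<lambda>i. \<beta> (i * k)"
    obtain l where l: "P c l" "\<forall>i<n. ?\<beta> i \<le> l ! i \<and> l ! i \<le> ?\<beta> (Suc i)"
      using h[OF fast_subsequence[OF \<beta> \<open>k > 0\<close>]] by blast
    have "dist (pt n ?\<beta>) (pt (n * k) \<beta>) \<le> 1 / real n"
      using dist_step_subsequence[of \<beta> k n] \<beta> n(1) \<open>k > 0\<close> by (simp add: pt fast_def)
    then have 1: "mdist m (f (pt n ?\<beta>)) (f (pt (n * k) \<beta>)) < e / 6"
      using n(2) by (intro \<delta>) simp
    have "dist (pt n ?\<beta>) (pt n ((!) l)) \<le> 1 / real n"
      using dist_step_interlaced[of n ?\<beta> "(!) l"] l(2) n(1) by (simp add: pt)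
    then have 2: "mdist m (f (pt n ?\<beta>)) (f (pt n ((!) l))) < e / 6"
      using n(2) by (intro \<delta>) simp
    have 3: "d c \<in> mspace m" "mdist m (f (pt n ((!) l))) (d c) < e / 6"
      using l(1) by (auto simp: P_def)
    have "mdist m (f (pt n ?\<beta>)) (d c) \<le> mdist m (f (pt n ?\<beta>)) (f (pt n ((!) l))) + mdist m (f (pt n ((!) l))) (d c)"
      by (intro mdist_triangle mem 3)
    moreover have "mdist m (f (pt (n * k) \<beta>)) (d c) \<le> mdist m (f (pt (n * k) \<beta>)) (f (pt n ?\<beta>)) + mdist m (f (pt n ?\<beta>)) (d c)"
      by (intro mdist_triangle mem 3)
    ultimately show ?thesis using 1 2 3 by (simp add: mdist_commute)
  qed
  have "mdist m (f (pt (n * k) \<beta>)) (f (pt (n * l) \<gamma>)) < e"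
    if "fast h \<beta>" "fast h \<gamma>" "k > 0" "l > 0" for \<beta> \<gamma> k l
  proof -
    note c = close[OF that(1,3)] close[OF that(2,4)]
    have "mdist m (f (pt (n * k) \<beta>)) (f (pt (n * l) \<gamma>)) \<le>
        mdist m (f (pt (n * k) \<beta>)) (d c) + mdist m (d c) (f (pt (n * l) \<gamma>))"
      using c by (intro mdist_triangle mem) auto
    with c show ?thesis by (simp add: mdist_commute)
  qed
  with n(1) show ?thesis by (intro exI[of _ h] exI[of _ n]) simp
qed

text \<open>If \<open>g\<close> is not small at the top, it differs there from the averages, which
  vanish. If it is, continuity makes it small at some countable ordinal \<open>a\<close>, where
  averages over sequences growing past \<open>a\<close> are at least 3/4.\<close>

lemma step_far_from_continuous:
  fixes g :: "omega1_closed \<Rightarrow>\<^sub>C real"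
  shows "\<exists>h. \<forall>\<beta> k. fast h \<beta> \<longrightarrow> k > 0 \<longrightarrow> 1 / 8 \<le> dist g (step_bcontfun (4 * k) \<beta>)"
proof (cases "\<bar>g top\<bar> < 1 / 4")
  case False
  have "1 / 8 \<le> dist g (step_bcontfun (4 * k) \<beta>)" if "k > 0" for k \<beta>
    using dist_bounded[of g top "step_bcontfun (4 * k) \<beta>"] that False step_bcontfun_in_M(3)[of "4 * k" \<beta>]
    by (simp add: dist_real_def)
  then show ?thesis by blast
next
  case True
  have "continuous_on UNIV (apply_bcontfun g)" by simp
  then have "open (apply_bcontfun g -` {-1/4<..<1/4})"
    by (rule open_vimage[rotated]) simp
  moreover have "top \<in> apply_bcontfun g -` {-1/4<..<1/4}" using True by auto
  moreover have "Below undefined < top" by (simp add: top_omega1_closed_def)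
  ultimately obtain b where b: "b < top" "{b<..top} \<subseteq> apply_bcontfun g -` {-1/4<..<1/4}"
    using open_left by blast
  then obtain b' where b': "b = Below b'" by (cases b) (auto simp: top_omega1_closed_def)
  obtain a where a: "b' < a" using countable_bounded_omega1[of "{b'}"] by auto
  have "Below a \<in> {b<..top}" using a b' by simp
  then have "Below a \<in> apply_bcontfun g -` {-1/4<..<1/4}" using b(2) by blast
  then have ga: "\<bar>g (Below a)\<bar> < 1 / 4" by auto
  have "1 / 8 \<le> dist g (step_bcontfun (4 * k) \<beta>)" if \<beta>: "fast (\<lambda>_. a) \<beta>" and "k > 0" for \<beta> k
  proof -
    \<comment> \<open>Only \<open>\<beta> 0\<close> can lie below \<open>a\<close>, so at most one
      of the \<open>4 * k\<close> terms is lost.\<close>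
    have "a \<le> \<beta> (Suc i)" for i using \<beta> by (auto simp: fast_def less_imp_le)
    then have "of_bool (i \<noteq> 0) \<le> (of_bool (Below a \<le> Below (\<beta> i)) :: real)" for i
      by (cases i) auto
    then have "(\<Sum>i<4*k. of_bool (i \<noteq> 0)) \<le> (\<Sum>i<4*k. of_bool (Below a \<le> Below (\<beta> i)) :: real)"
      by (rule sum_mono)
    moreover have "(\<Sum>i<4*k. of_bool (i \<noteq> 0)) = (real (4 * k) - 1 :: real)"
      using sum.lessThan_Suc_shift[of "\<lambda>i. of_bool (i \<noteq> 0) :: real" "4 * k - 1"] \<open>k > 0\<close> by simp
    ultimately have "(real (4 * k) - 1) / real (4 * k) \<le> step_fun (4 * k) \<beta> (Below a)"
      unfolding step_fun_def by (intro divide_right_mono) auto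
    moreover have "3 / 4 \<le> (real (4 * k) - 1) / real (4 * k)" using \<open>k > 0\<close> by (simp add: field_simps)
    ultimately have "3 / 4 \<le> step_fun (4 * k) \<beta> (Below a)" by (rule order_trans[rotated])
    then show ?thesis
      using dist_bounded[of g "Below a" "step_bcontfun (4 * k) \<beta>"] ga by (simp add: dist_real_def)
  qed
  then show ?thesis by blast
qed

text \<open>Stated for any isometric copy of a set of functions containing \<open>M\<close>, so that
  both claims are instances.\<close>

lemma not_complete_separable_modification:
  fixes J :: "'a :: metric_space \<Rightarrow> omega1_closed \<Rightarrow>\<^sub>C real"
  assumes iso: "\<And>x y. dist (J x) (J y) = dist x y"
    and range: "\<And>f :: omega1_closed \<Rightarrow>\<^sub>C real.
      antimono (apply_bcontfun f) \<Longrightarrow> f bot = 1 \<Longrightarrow> f top = 0 \<Longrightarrow> f \<in> range J"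
  shows "\<not> complete (UNIV :: 'a separable_modification set)"
proof
  assume complete: "complete (UNIV :: 'a separable_modification set)"
  have "\<exists>x. n > 0 \<longrightarrow> J x = step_bcontfun n \<alpha>" for n \<alpha>
    using range[OF step_bcontfun_in_M] by (metis imageE)
  then obtain pt where J_pt: "\<And>n \<alpha>. n > 0 \<Longrightarrow> J (pt n \<alpha>) = step_bcontfun n \<alpha>" by metis
  have pt: "dist (pt n \<alpha>) (pt k \<beta>) = dist (step_bcontfun n \<alpha>) (step_bcontfun k \<beta>)"
    if "n > 0" "k > 0" for n k \<alpha> \<beta>
    using that by (simp add: iso[symmetric] J_pt)
  \<comment> \<open>Requiring only that \<open>n\<close> divides the length of the average makes the base directed.\<close>
  define B where "B = (\<lambda>(h, n). {p1_of_point (pt (n * k) \<beta>) | k \<beta>. k > (0::nat) \<and> fast h \<beta>})"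
  have B: "p1_of_point (pt (n * k) \<beta>) \<in> B (h, n)" if "k > 0" "fast h \<beta>" for h n k \<beta>
    using that by (auto simp: B_def)
  define I where "I = (UNIV :: (omega1 \<Rightarrow> omega1) set) \<times> {0::nat<..}"
  define F where "F = (INF p\<in>I. principal (B p))"
  have ev: "eventually Q F \<longleftrightarrow> (\<exists>p\<in>I. \<forall>x\<in>B p. Q x)" for Q
    unfolding F_def eventually_principal[symmetric]
  proof (rule eventually_INF_base)
    show "I \<noteq> {}" by (auto simp: I_def)
    fix p q assume "p \<in> I" "q \<in> I"
    then obtain h n h' n' where pq: "p = (h, n)" "q = (h', n')" "n > 0" "n' > 0"
      by (auto simp: I_def)
    have "B (\<lambda>x. max (h x) (h' x), n * n') \<subseteq> B p \<inter> B q"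
    proof
      fix x assume "x \<in> B (\<lambda>x. max (h x) (h' x), n * n')"
      then obtain k \<beta> where x: "x = p1_of_point (pt (n * n' * k) \<beta>)" "k > 0"
        and \<beta>: "fast (\<lambda>x. max (h x) (h' x)) \<beta>" by (auto simp: B_def)
      have "fast h \<beta>" "fast h' \<beta>" using fast_mono[OF \<beta>] by auto
      moreover have "n' * k > 0" "n * k > 0" using x(2) pq by auto
      ultimately show "x \<in> B p \<inter> B q"
        using B[of "n' * k" h \<beta> n] B[of "n * k" h' \<beta> n'] by (simp add: x(1) pq ac_simps)
    qed
    moreover have "(\<lambda>x. max (h x) (h' x), n * n') \<in> I" using pq by (simp add: I_def)
    ultimately show "\<exists>x\<in>I. principal (B x) \<le> inf (principal (B p)) (principal (B q))"
      by auto
  qed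
  have B_nonempty: "B p \<noteq> {}" for p
  proof -
    obtain \<beta> where "fast (fst p) \<beta>" using fast_exists by blast
    then have "p1_of_point (pt (snd p * 1) \<beta>) \<in> B (fst p, snd p)" by (intro B) simp_all
    then show ?thesis by auto
  qed
  have "F \<noteq> bot"
    unfolding trivial_limit_def ev using B_nonempty by blast
  moreover have "cauchy_filter F"
    unfolding cauchy_filter_def uniformity_separable_modification_def
  \<comment> \<open>The Cauchy property need only be tested on the generating entourages, and
    near-constancy gives a small base set for each.\<close>
  proof (intro INF_greatest, clarify)
    fix m :: "real metric" and f :: "'a \<Rightarrow> real" and e :: real
    assume "separable_space (mtopology_of m)" "uniformly_continuous_into_metric m f" "e > 0"
    from uniformly_continuous_almost_constant[OF pt this]
    obtain h n where hn: "n > 0" "\<And>\<beta> \<gamma> k l. fast h \<beta> \<Longrightarrow> fast h \<gamma> \<Longrightarrow> k > 0 \<Longrightarrow> l > 0 \<Longrightarrow>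
        mdist m (f (pt (n * k) \<beta>)) (f (pt (n * l) \<gamma>)) < e" by blast
    have "eventually (\<lambda>x. x \<in> B (h, n)) F"
      unfolding ev using hn(1) by (intro bexI[of _ "(h, n)"]) (auto simp: I_def)
    moreover have "mdist m (f (point_of_p1 x)) (f (point_of_p1 y)) < e"
      if "x \<in> B (h, n)" "y \<in> B (h, n)" for x y
      using that hn(2) by (auto simp: B_def p1_of_point_inverse)
    ultimately show "F \<times>\<^sub>F F \<le> principal {(x, y). mdist m (f (point_of_p1 x)) (f (point_of_p1 y)) < e}"
      unfolding le_principal eventually_prod_same by (auto intro!: exI[of _ "\<lambda>x. x \<in> B (h, n)"])
  qed
  ultimately obtain z where z: "F \<le> nhds z"
    using complete unfolding complete_uniform by auto
  define g where "g = point_of_p1 z"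
  \<comment> \<open>The distance to the supposed limit maps into the separable real line, so it
    stays uniformly continuous on the modification. Convergence there therefore forces convergence
    in norm.\<close>
  have "uniformly_continuous_into_metric euclidean_metric (dist g)"
    unfolding uniformly_continuous_into_metric_def eventually_uniformity_metric
  proof (clarsimp, intro exI conjI allI impI)
    fix e :: real and x y :: 'a assume "dist x y < e"
    then show "dist (dist g x) (dist g y) < e"
      by (metis abs_dist_diff_le dist_commute dist_real_def le_less_trans)
  qed auto
  moreover have "separable_space (mtopology_of (euclidean_metric :: real metric))"
    using countable_rat Rats_closure_real by (auto simp: separable_space_def)
  ultimately have "uniformly_continuous_into_metric euclidean_metric (\<lambda>x. dist g (point_of_p1 x))"
    by (intro uniformly_continuous_p1_separable)
  then have "\<forall>\<^sub>F (x, y) in uniformity. dist (dist g (point_of_p1 x)) (dist g (point_of_p1 y)) < 1 / 8"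
    unfolding uniformly_continuous_into_metric_def mdist_euclidean_metric
    by (elim conjE allE[of _ "1 / 8"]) simp
  then have "\<forall>\<^sub>F y in nhds z. dist g (point_of_p1 y) < 1 / 8"
    unfolding eventually_nhds_uniformity by (rule eventually_mono) (auto simp: g_def)
  then have "\<forall>\<^sub>F y in F. dist g (point_of_p1 y) < 1 / 8"
    using z by (simp add: le_filter_def)
  then obtain h n where "n > 0" and near: "\<And>y. y \<in> B (h, n) \<Longrightarrow> dist g (point_of_p1 y) < 1 / 8"
    unfolding ev by (auto simp: I_def)
  obtain h' where h': "\<And>\<beta> k. fast h' \<beta> \<Longrightarrow> k > 0 \<Longrightarrow> 1 / 8 \<le> dist (J g) (step_bcontfun (4 * k) \<beta>)"
    using step_far_from_continuous by blast
  obtain \<beta> where \<beta>: "fast (\<lambda>x. max (h x) (h' x)) \<beta>" using fast_exists by blast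
  have "fast h \<beta>" "fast h' \<beta>" using fast_mono[OF \<beta>] by auto
  \<comment> \<open>The length is a multiple of \<open>n\<close> for membership in the base set and
    of 4 for the lower bound.\<close>
  have "p1_of_point (pt (n * 4) \<beta>) \<in> B (h, n)"
    using \<open>fast h \<beta>\<close> by (intro B) simp_all
  then have "dist g (pt (n * 4) \<beta>) < 1 / 8"
    using near by (force simp: p1_of_point_inverse)
  moreover have "1 / 8 \<le> dist g (pt (n * 4) \<beta>)"
    using h'[OF \<open>fast h' \<beta>\<close> \<open>n > 0\<close>] \<open>n > 0\<close> by (simp add: iso[symmetric] J_pt mult.commute)
  ultimately show False by simp
qed

theorem theorem8:
  shows "\<not> complete (UNIV :: M_omega1 separable_modification set) \<and>
         \<not> complete (UNIV :: (omega1_closed \<Rightarrow>\<^sub>C real) separable_modification set)"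
proof
  show "\<not> complete (UNIV :: M_omega1 separable_modification set)"
  proof (rule not_complete_separable_modification[of fun_of_M])
    fix f :: "omega1_closed \<Rightarrow>\<^sub>C real"
    assume "antimono (apply_bcontfun f)" "f bot = 1" "f top = 0"
    then show "f \<in> range fun_of_M"
      using type_definition.Rep_range[OF type_definition_M_omega1] by simp
  qed (simp add: dist_M_omega1_def)
  show "\<not> complete (UNIV :: (omega1_closed \<Rightarrow>\<^sub>C real) separable_modification set)"
    by (rule not_complete_separable_modification[of "\<lambda>x. x"]) simp_all
qed

end
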